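(* Let $(R,v)$ be a discrete valuation domain with a uniformizing parameter $\pi$. Let $f=\sum_{i=0}^\infty a_i z^i\in R[[z]]$ be such that $a_0=u\pi^k$ for some unit $u\in R$ and positive integer $k$. Suppose there exist a nonnegative integer $\ell$ and an index $j\geq 1$ such that $\pi^{\ell}$ divides $a_j$ but $\pi^{\ell+1}$ does not divide $a_j$. Then $f$ is a product of at most $\min\{k,j+\ell\}$ irreducible factors in $R[[z]]$. In particular, if $k=1$, or if $j=1$ and $\ell=0$, then $f$ is irreducible in $R[[z]]$.
   Context: $R[[z]]$ denotes the ring of formal power series in $z$ over $R$; irreducible factors are counted with multiplicity. The valuation $v$ is normalized so that $v(\pi)=1$, with $v(0)=\infty$. *)

theory Defs
  imports
    "HOL-Computational_Algebra.Computational_Algebra"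
    "HOL-Library.Multiset"
    "HOL-Library.Extended"
begin

text \<open>
  The range condition excludes the value \<open>-\<infinity>\<close> of \<^typ>\<open>int extended\<close> and
  normalizes the valuation: every integer is attained.
\<close>

definition discrete_valuation :: "('k::field \<Rightarrow> int extended) \<Rightarrow> bool" where
  "discrete_valuation v \<longleftrightarrow>
     range v = insert \<infinity> (range Fin) \<and>
     (\<forall>x. v x = \<infinity> \<longleftrightarrow> x = 0) \<and>
     (\<forall>x y. v (x * y) = v x + v y) \<and>
     (\<forall>x y. min (v x) (v y) \<le> v (x + y))"

text \<open>
  The ring is the type \<open>'r\<close>, embedded into its field of fractions by
  \<open>\<lambda>r. Fract r 1\<close>; it is required to be exactly the valuation ring of \<open>v\<close>.
\<close>

definition discrete_valuation_domain :: "('r::idom fract \<Rightarrow> int extended) \<Rightarrow> bool" where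
  "discrete_valuation_domain v \<longleftrightarrow>
     discrete_valuation v \<and> range (\<lambda>r::'r. Fract r 1) = {x. 0 \<le> v x}"

definition uniformizing_parameter :: "('r::idom fract \<Rightarrow> int extended) \<Rightarrow> 'r \<Rightarrow> bool" where
  "uniformizing_parameter v \<pi> \<longleftrightarrow> v (Fract \<pi> 1) = 1"

end

theory Submission
  imports Defs
begin

text \<open>
  A power series over a commutative ring is a unit exactly when its constant term is one, and in a
  discrete valuation domain the non-units are the multiples of \<open>\<pi>\<close>. Every irreducible power
  series therefore has a constant term divisible by \<open>\<pi>\<close>.

  In a product of \<open>n\<close> such series, the coefficient of \<open>z\<^sup>i\<close> is a sum of products of coefficients
  whose indices add up to \<open>i\<close>. At most \<open>i\<close> of these indices are positive, so at least \<open>n - i\<close>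
  factors are constant terms and \<open>\<pi>\<close> to the power \<open>n - i\<close> divides the sum
  (\<open>power_dvd_prod_mset_nth\<close>). Both bounds are instances of this fact: the coefficient at
  \<open>j\<close> gives \<open>n - j \<le> l\<close>, and the coefficient at \<open>0\<close>, which is divisible by \<open>\<pi>\<^sup>k\<close> but by no higher
  power, gives \<open>n \<le> k\<close>.

  A factorization exists because splitting a series into two non-units strictly lowers the power of
  \<open>\<pi>\<close> in the constant term of each part (\<open>fps_irreducible_factorization_exists\<close>). When the
  minimum is \<open>1\<close>, such a factorization has a single factor, so the series is itself irreducible.
\<close>

lemma fps_dvd_one_iff:
  fixes g :: "'a::comm_ring_1 fps"
  shows "g dvd 1 \<longleftrightarrow> fps_nth g 0 dvd 1"
proof
  assume "g dvd 1"
  then obtain h where "1 = g * h" by (rule dvdE)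
  then have "fps_nth g 0 * fps_nth h 0 = 1"
    by (metis fps_mult_nth_0 fps_one_nth)
  then show "fps_nth g 0 dvd 1" by (metis dvd_triv_left)
next
  assume "fps_nth g 0 dvd 1"
  then obtain y where "1 = fps_nth g 0 * y" by (rule dvdE)
  then have "g * fps_right_inverse g y = 1" by (simp add: fps_right_inverse)
  then show "g dvd 1" by (metis dvd_triv_left)
qed

text \<open>
  Multiplying by one more series \<open>g\<close> either contributes its constant term, which supplies the extra
  factor \<open>p\<close>, or lowers the index of the coefficient taken from the remaining product; there the
  induction hypothesis for the smaller index already gives the full exponent.
\<close>

lemma power_dvd_prod_mset_nth:
  fixes p :: "'a::comm_semiring_1"
  assumes "\<And>g. g \<in># F \<Longrightarrow> p dvd fps_nth g 0"
  shows "p ^ (size F - i) dvd fps_nth (prod_mset F) i"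
  using assms
proof (induction F arbitrary: i)
  case empty
  then show ?case by simp
next
  case (add g F)
  have "p ^ (size (add_mset g F) - i) dvd fps_nth g m * fps_nth (prod_mset F) (i - m)"
    if "m \<le> i" for m
  proof (cases "m = 0")
    case True
    have "p * p ^ (size F - i) dvd fps_nth g 0 * fps_nth (prod_mset F) i"
      using add by (intro mult_dvd_mono) auto
    moreover have "p ^ (size (add_mset g F) - i) dvd p ^ Suc (size F - i)"
      by (rule le_imp_power_dvd) simp
    ultimately show ?thesis
      using True by (metis diff_zero dvd_trans power_Suc)
  next
    case False
    have "p ^ (size (add_mset g F) - i) dvd p ^ (size F - (i - m))"
      using False that by (intro le_imp_power_dvd) simp
    also have "\<dots> dvd fps_nth (prod_mset F) (i - m)"
      using add by simp
    finally show ?thesis by (rule dvd_mult)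
  qed
  then show ?case
    by (auto simp: fps_mult_nth intro!: dvd_sum)
qed

lemma size_le_add_of_prod_mset_nth:
  fixes p :: "'a::comm_semiring_1"
  assumes "\<And>g. g \<in># F \<Longrightarrow> p dvd fps_nth g 0"
    and "\<not> p ^ Suc l dvd fps_nth (prod_mset F) i"
  shows "size F \<le> i + l"
proof (rule ccontr)
  assume "\<not> size F \<le> i + l"
  then have "p ^ Suc l dvd p ^ (size F - i)"
    by (intro le_imp_power_dvd) simp
  also have "\<dots> dvd fps_nth (prod_mset F) i"
    using assms(1) by (rule power_dvd_prod_mset_nth)
  finally show False using assms(2) by contradiction
qed

text \<open>
  The exponent \<open>n\<close> is the measure of the recursion: if \<open>f = a * b\<close> with non-units \<open>a\<close> and \<open>b\<close>, then
  \<open>p\<close> divides the constant term of either factor, so the constant term of the other one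
  contains at least one factor \<open>p\<close> fewer than that of \<open>f\<close>.
\<close>

lemma fps_irreducible_factorization_exists:
  fixes p :: "'a::idom"
  assumes nonunit: "\<And>r. \<not> r dvd 1 \<Longrightarrow> p dvd r"
    and "\<not> f dvd 1" and "\<not> p ^ n dvd fps_nth f 0"
  shows "\<exists>F. (\<forall>g\<in>#F. irreducible g) \<and> prod_mset F = f"
  using assms(2,3)
proof (induction n arbitrary: f)
  case 0
  then show ?case by simp
next
  case (Suc n)
  show ?case
  proof (cases "irreducible f")
    case True
    then show ?thesis by (intro exI[of _ "{#f#}"]) simp
  next
    case False
    have "f \<noteq> 0" using Suc.prems by auto
    with False Suc.prems obtain a b
      where f: "f = a * b" and a: "\<not> a dvd 1" and b: "\<not> b dvd 1"
      by (auto simp: irreducible_def)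
    have pa: "p dvd fps_nth a 0" and pb: "p dvd fps_nth b 0"
      using a b by (simp_all add: fps_dvd_one_iff nonunit)
    have "\<not> p ^ n dvd fps_nth a 0"
    proof
      assume "p ^ n dvd fps_nth a 0"
      then have "p ^ n * p dvd fps_nth a 0 * fps_nth b 0" using pb by (rule mult_dvd_mono)
      then show False using Suc.prems f by (simp add: mult.commute)
    qed
    moreover have "\<not> p ^ n dvd fps_nth b 0"
    proof
      assume "p ^ n dvd fps_nth b 0"
      with pa have "p * p ^ n dvd fps_nth a 0 * fps_nth b 0" by (rule mult_dvd_mono)
      then show False using Suc.prems f by simp
    qed
    ultimately obtain A B where "\<forall>g\<in>#A. irreducible g" "prod_mset A = a"
      "\<forall>g\<in>#B. irreducible g" "prod_mset B = b"
      using Suc.IH a b by metis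
    then show ?thesis using f by (intro exI[of _ "A + B"]) auto
  qed
qed

text \<open>
  The quotient of \<open>b\<close> by \<open>a\<close> in the field of fractions has value \<open>v b - v a\<close>, and the ring consists
  of exactly those fractions whose value is nonnegative.
\<close>

lemma dvd_iff_valuation_le:
  fixes v :: "'r::idom fract \<Rightarrow> int extended" and a b :: 'r
  assumes "discrete_valuation_domain v"
  shows "a dvd b \<longleftrightarrow> v (Fract a 1) \<le> v (Fract b 1)"
proof -
  have mult: "v (x * y) = v x + v y" and inf: "v x = \<infinity> \<longleftrightarrow> x = 0" for x y
    using assms by (simp_all add: discrete_valuation_domain_def discrete_valuation_def)
  have ring: "0 \<le> v x \<longleftrightarrow> (\<exists>c::'r. x = Fract c 1)" for x
    using assms unfolding discrete_valuation_domain_def by blast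
  show ?thesis
  proof
    assume "a dvd b"
    then obtain c where "b = a * c" by (rule dvdE)
    then have "v (Fract b 1) = v (Fract a 1) + v (Fract c 1)"
      by (simp flip: mult)
    moreover have "0 \<le> v (Fract c 1)" using ring by blast
    ultimately show "v (Fract a 1) \<le> v (Fract b 1)"
      by (metis add.right_neutral add_left_mono)
  next
    assume le: "v (Fract a 1) \<le> v (Fract b 1)"
    show "a dvd b"
    proof (cases "a = 0")
      case True
      then have "v (Fract a 1) = \<infinity>" by (simp add: inf Zero_fract_def)
      then have "Fract b 1 = 0" using le by (simp flip: inf)
      then show ?thesis by (simp add: Zero_fract_def eq_fract)
    next
      case False
      have "Fract b 1 = Fract a 1 * Fract b a" using False by (simp add: eq_fract)
      then have sum: "v (Fract b 1) = v (Fract a 1) + v (Fract b a)" by (simp flip: mult)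
      have "v (Fract a 1) \<noteq> \<infinity>" using False by (simp add: inf Zero_fract_def eq_fract)
      moreover have "0 \<le> v (Fract a 1)" using ring by blast
      ultimately have "0 \<le> v (Fract b a)"
        using le sum
        by (cases "v (Fract a 1)"; cases "v (Fract b a)") (auto simp: zero_extended_def)
      then obtain c where "Fract b a = Fract c 1" using ring by blast
      then show ?thesis using False by (simp add: eq_fract)
    qed
  qed
qed

text \<open>
  Units have value \<open>0\<close>. Since finite values are integers, every other ring element has value at
  least \<open>1\<close>, which is the value of \<open>\<pi>\<close>.
\<close>

lemma uniformizing_parameter_dvd_iff:
  fixes v :: "'r::idom fract \<Rightarrow> int extended"
  assumes "discrete_valuation_domain v" and "uniformizing_parameter v \<pi>"
  shows "\<pi> dvd r \<longleftrightarrow> \<not> r dvd 1"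
proof -
  have "v 1 = v 1 + v 1" "v 1 \<noteq> \<infinity>" "0 \<le> v 1"
    using assms(1) mult_1[of "1 :: 'r fract"]
    unfolding discrete_valuation_domain_def discrete_valuation_def One_fract_def
    by (metis, metis One_fract_def zero_neq_one, blast)
  then have "v (Fract 1 1) = 0"
    by (cases "v 1") (auto simp: zero_extended_def One_fract_def)
  moreover have "0 \<le> v (Fract r 1)"
    using assms(1) unfolding discrete_valuation_domain_def by blast
  ultimately show ?thesis
    using assms(2)
    unfolding dvd_iff_valuation_le[OF assms(1)] uniformizing_parameter_def
    by (cases "v (Fract r 1)") (auto simp: zero_extended_def one_extended_def)
qed

theorem theorem4:
  fixes v :: "'r::idom fract \<Rightarrow> int extended"
    and \<pi> u :: 'r
    and f :: "'r fps"
    and k l j :: nat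
  assumes "discrete_valuation_domain v"
    and "uniformizing_parameter v \<pi>"
    and "u dvd 1"
    and "k > 0"
    and "fps_nth f 0 = u * \<pi> ^ k"
    and "j \<ge> 1"
    and "\<pi> ^ l dvd fps_nth f j"
    and "\<not> \<pi> ^ (l + 1) dvd fps_nth f j"
  shows "(\<exists>F. (\<forall>g\<in>#F. irreducible g) \<and> prod_mset F = f \<and> size F \<le> min k (j + l)) \<and>
         (\<forall>F. (\<forall>g\<in>#F. irreducible g) \<and> prod_mset F = f \<longrightarrow> size F \<le> min k (j + l)) \<and>
         (k = 1 \<or> (j = 1 \<and> l = 0) \<longrightarrow> irreducible f)"
proof -
  have nonunit: "\<pi> dvd r \<longleftrightarrow> \<not> r dvd 1" for r
    using uniformizing_parameter_dvd_iff assms(1,2) by blast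
  have "\<not> \<pi> dvd 1" by (simp add: nonunit)
  have "\<pi> \<noteq> 0"
    using assms(1,2) unfolding uniformizing_parameter_def discrete_valuation_domain_def
      discrete_valuation_def by (metis Zero_fract_def extended.distinct(1) one_extended_def)
  have "\<pi> dvd fps_nth f 0" using assms(4,5) by simp
  then have "\<not> f dvd 1" by (simp add: fps_dvd_one_iff nonunit)
  have k: "\<not> \<pi> ^ Suc k dvd fps_nth f 0"
  proof
    assume "\<pi> ^ Suc k dvd fps_nth f 0"
    then have "\<pi> dvd u" using assms(5) \<open>\<pi> \<noteq> 0\<close> by simp
    then show False using assms(3) nonunit by blast
  qed
  have bound: "size F \<le> min k (j + l)"
    if "\<forall>g\<in>#F. irreducible g" "prod_mset F = f" for F
  proof -
    have "\<pi> dvd fps_nth g 0" if "g \<in># F" for g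
      using that \<open>\<forall>g\<in>#F. irreducible g\<close> by (auto simp: irreducible_def nonunit fps_dvd_one_iff)
    then have "size F \<le> i + m" if "\<not> \<pi> ^ Suc m dvd fps_nth f i" for i m
      using that \<open>prod_mset F = f\<close> size_le_add_of_prod_mset_nth by blast
    from this[of k 0] this[of l j] show ?thesis using k assms(8) by simp
  qed
  obtain F where F: "\<forall>g\<in>#F. irreducible g" "prod_mset F = f"
    using fps_irreducible_factorization_exists[of \<pi> f "Suc k"] nonunit \<open>\<not> f dvd 1\<close> k by blast
  have "irreducible f" if "k = 1 \<or> j = 1 \<and> l = 0"
  proof -
    have "size F \<le> 1" using bound[OF F] that by auto
    moreover have "F \<noteq> {#}" using F(2) \<open>\<not> f dvd 1\<close> by auto
    ultimately have "size F = 1" by (metis le_antisym less_one not_le size_eq_0_iff_empty)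
    then obtain g where "F = {#g#}" by (rule size_1_singleton_mset[THEN exE])
    then show ?thesis using F by simp
  qed
  then show ?thesis using bound F by blast
qed

end
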